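(* For any finite graph $G$, $\sigma(G) \leq \mathrm{tw}(G) + 1$, where $\mathrm{tw}(G)$ denotes the treewidth of $G$.
   Context: Surrounding Cops and Robbers on a finite simple graph $G$ with $k \geq 1$ cops and one robber: the cops first choose starting vertices (several cops may share a vertex), then the robber chooses a starting vertex not occupied by a cop, and thereafter the cops and the robber alternate moves, the cops moving first. In a move, each player may move to an adjacent vertex or stay put; the robber may never move to, or remain on, a vertex occupied by a cop, so if a cop moves onto the robber's vertex the robber is compelled to move to a neighbouring vertex not occupied by a cop. The cops win if at any time every neighbour of the robber's vertex is occupied by a cop; the robber wins if he avoids this forever. Play is with perfect information. The surrounding cop number $\sigma(G)$ is the least number of cops for which the cops have a winning strategy. Treewidth is the usual notion: the minimum, over tree decompositions of $G$, of the maximum bag size minus one.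
   Formalization: The graph G is additionally assumed connected (and non-empty): for disconnected graphs the bound fails, e.g. three disjoint edges have treewidth 1 but surrounding cop number 3. *)

theory Defs
  imports "Graph_Theory.Digraph_Component"
begin

text \<open>
  Finite simple graphs are the library's \<^const>\<open>pair_graph\<close>s: finite, loop-free, with a
  symmetric arc relation.  The library's \<^const>\<open>Digraph_Component.connected\<close> includes
  non-emptiness of the vertex set.

  As usual for pursuit games, the bound is meant for connected graphs.  It fails otherwise: on three
  disjoint edges (treewidth 1) two cops leave one edge unguarded, where a robber is never
  surrounded.
\<close>

section \<open>The game\<close>

text \<open>
  \<open>k\<close> cops are a list of length \<open>k\<close>, so that several of them may share a vertex.
  A position is the pair of the cops' vertices and the robber's vertex after a complete round.
\<close>

type_synonym 'v position = "'v list \<times> 'v"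

definition step :: "'v pair_pre_digraph \<Rightarrow> 'v \<Rightarrow> 'v \<Rightarrow> bool" where
  "step G u v \<longleftrightarrow> v = u \<or> (u, v) \<in> parcs G"

definition cop_placement :: "'v pair_pre_digraph \<Rightarrow> nat \<Rightarrow> 'v list \<Rightarrow> bool" where
  "cop_placement G k cs \<longleftrightarrow> length cs = k \<and> set cs \<subseteq> pverts G"

definition cop_move :: "'v pair_pre_digraph \<Rightarrow> 'v list \<Rightarrow> 'v list \<Rightarrow> bool" where
  "cop_move G cs cs' \<longleftrightarrow> list_all2 (step G) cs cs'"

definition robber_placement :: "'v pair_pre_digraph \<Rightarrow> 'v list \<Rightarrow> 'v \<Rightarrow> bool" where
  "robber_placement G cs r \<longleftrightarrow> r \<in> pverts G \<and> r \<notin> set cs"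

definition robber_move :: "'v pair_pre_digraph \<Rightarrow> 'v list \<Rightarrow> 'v \<Rightarrow> 'v \<Rightarrow> bool" where
  "robber_move G cs r r' \<longleftrightarrow> step G r r' \<and> r' \<notin> set cs"

definition surrounded :: "'v pair_pre_digraph \<Rightarrow> 'v list \<Rightarrow> 'v \<Rightarrow> bool" where
  "surrounded G cs r \<longleftrightarrow> {u. (r, u) \<in> parcs G} \<subseteq> set cs"

text \<open>
  A strategy for the cops is an initial placement \<open>c0\<close> together with a function \<open>S\<close> from
  (non-empty) histories of positions to the cops' next vertices.
\<close>

definition cop_strategy ::
  "'v pair_pre_digraph \<Rightarrow> nat \<Rightarrow> 'v list \<Rightarrow> ('v position list \<Rightarrow> 'v list) \<Rightarrow> bool" where
  "cop_strategy G k c0 S \<longleftrightarrow>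
     cop_placement G k c0 \<and> (\<forall>h. h \<noteq> [] \<longrightarrow> cop_move G (fst (last h)) (S h))"

text \<open>
  \<open>c n\<close> and \<open>r n\<close> are the vertices of the cops and of the robber after round \<open>n\<close>, round 0
  being the placement.
\<close>

definition consistent_play ::
  "'v pair_pre_digraph \<Rightarrow> 'v list \<Rightarrow> ('v position list \<Rightarrow> 'v list) \<Rightarrow>
   (nat \<Rightarrow> 'v list) \<Rightarrow> (nat \<Rightarrow> 'v) \<Rightarrow> bool" where
  "consistent_play G c0 S c r \<longleftrightarrow>
     c 0 = c0 \<and> robber_placement G (c 0) (r 0) \<and>
     (\<forall>n. c (Suc n) = S (map (\<lambda>i. (c i, r i)) [0..<Suc n]) \<and>
          robber_move G (c (Suc n)) (r n) (r (Suc n)))"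

text \<open>
  A strategy wins if no infinite play consistent with it lets the robber avoid being surrounded
  forever, both after his own moves and after the cops' moves.  Restricting to infinite plays
  loses nothing: by \<open>robber_can_move\<close> below, a play can only break off when the robber is
  surrounded (or when every vertex carries a cop at the start, which counts as a win for the cops).
\<close>

definition winning_cop_strategy ::
  "'v pair_pre_digraph \<Rightarrow> nat \<Rightarrow> 'v list \<Rightarrow> ('v position list \<Rightarrow> 'v list) \<Rightarrow> bool" where
  "winning_cop_strategy G k c0 S \<longleftrightarrow>
     cop_strategy G k c0 S \<and>
     (\<forall>c r. consistent_play G c0 S c r \<longrightarrow>
        (\<exists>n. surrounded G (c n) (r n) \<or> surrounded G (c (Suc n)) (r n)))"

lemma robber_can_move:
  assumes "\<not> surrounded G cs r"
  shows "\<exists>r'. robber_move G cs r r'"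
  using assms by (auto simp: surrounded_def robber_move_def step_def)

definition cops_win :: "'v pair_pre_digraph \<Rightarrow> nat \<Rightarrow> bool" where
  "cops_win G k \<longleftrightarrow> (\<exists>c0 S. winning_cop_strategy G k c0 S)"

definition surrounding_cop_number :: "'v pair_pre_digraph \<Rightarrow> nat" where
  "surrounding_cop_number G = (LEAST k. 1 \<le> k \<and> cops_win G k)"

lemma surrounding_cop_number_well_defined:
  assumes "finite (pverts G)" "pverts G \<noteq> {}"
  shows "\<exists>k. 1 \<le> k \<and> cops_win G k"
proof -
  obtain cs where cs: "set cs = pverts G"
    using finite_list[OF assms(1)] by blast
  have "cop_strategy G (length cs) cs (\<lambda>h. fst (last h))"
    using cs by (simp add: cop_strategy_def cop_placement_def cop_move_def step_def list.rel_refl)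
  moreover have "\<not> consistent_play G cs (\<lambda>h. fst (last h)) c r" for c r
    using cs by (auto simp: consistent_play_def robber_placement_def)
  ultimately have "cops_win G (length cs)"
    unfolding cops_win_def winning_cop_strategy_def by blast
  moreover have "1 \<le> length cs"
    using cs assms(2) by (cases cs) auto
  ultimately show ?thesis by blast
qed

section \<open>Treewidth\<close>

text \<open>
  The library's \<^const>\<open>tree\<close> forbids directed cycles only, and \<open>a, b, a\<close> is a directed cycle of
  any symmetric digraph with an edge, so it does not describe undirected trees.  In a
  \<^const>\<open>pair_graph\<close> the cycles of the undirected graph are exactly the directed cycles with at
  least three arcs.
\<close>

definition undirected_tree :: "'t pair_pre_digraph \<Rightarrow> bool" where
  "undirected_tree T \<longleftrightarrow>
     pair_graph T \<and> Digraph_Component.connected (with_proj T) \<and>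
     \<not> (\<exists>p. pre_digraph.cycle (with_proj T) p \<and> 3 \<le> length p)"

definition tree_decomposition ::
  "'v pair_pre_digraph \<Rightarrow> 't pair_pre_digraph \<Rightarrow> ('t \<Rightarrow> 'v set) \<Rightarrow> bool" where
  "tree_decomposition G T B \<longleftrightarrow>
     undirected_tree T \<and>
     (\<Union>t\<in>pverts T. B t) = pverts G \<and>
     (\<forall>(u, v)\<in>parcs G. \<exists>t\<in>pverts T. u \<in> B t \<and> v \<in> B t) \<and>
     (\<forall>v\<in>pverts G. Digraph_Component.connected (with_proj T \<restriction> {t \<in> pverts T. v \<in> B t}))"

text \<open>
  The truncated subtraction is harmless for graphs with at least one vertex, where some bag is
  non-empty.
\<close>

definition width :: "'t pair_pre_digraph \<Rightarrow> ('t \<Rightarrow> 'v set) \<Rightarrow> nat" where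
  "width T B = Max ((\<lambda>t. card (B t)) ` pverts T) - 1"

text \<open>
  The nodes of decomposition trees are taken to be natural numbers, which is no restriction
  as the trees are finite.
\<close>

definition treewidth :: "'v pair_pre_digraph \<Rightarrow> nat" where
  "treewidth G =
     (LEAST w. \<exists>(T :: nat pair_pre_digraph) B. tree_decomposition G T B \<and> width T B = w)"

lemma treewidth_well_defined:
  assumes "pair_graph G"
  shows "\<exists>(T :: nat pair_pre_digraph) B. tree_decomposition G T B"
proof -
  interpret pair_graph G by fact
  define T :: "nat pair_pre_digraph" where "T = \<lparr>pverts = {0}, parcs = {}\<rparr>"
  have "pair_graph T"
    by unfold_locales (auto simp: T_def symmetric_def)
  moreover have "Digraph_Component.connected (with_proj T)"
    by (simp add: T_def Digraph_Component.connected_def strongly_connected_def mk_symmetric_def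
        reachable_def)
  moreover have "\<not> pre_digraph.cycle (with_proj T) p" for p
    by (auto simp: T_def pre_digraph.cycle_def pre_digraph.awalk_def)
  ultimately have "undirected_tree T"
    by (auto simp: undirected_tree_def)
  moreover have "Digraph_Component.connected (with_proj T \<restriction> {t \<in> pverts T. v \<in> pverts G})"
    if "v \<in> pverts G" for v
    using that by (simp add: T_def Digraph_Component.connected_def strongly_connected_def
        mk_symmetric_def reachable_def)
  ultimately have "tree_decomposition G T (\<lambda>_. pverts G)"
    by (auto simp: tree_decomposition_def T_def dest: in_arcsD1 in_arcsD2)
  then show ?thesis by blast
qed

end

theory Submission
  imports Defs
begin

text \<open>
  Take an optimal tree decomposition and place cops on a whole bag \<open>B t\<close>. The robber then lives in
  the bags of a single branch of the tree at \<open>t\<close>; let \<open>s\<close> be the neighbour of \<open>t\<close> in it. The cops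
  on \<open>B t \<inter> B s\<close> stay, which already keeps him in this branch, while the others walk to the rest of
  \<open>B s\<close>. Once \<open>B s\<close> is occupied he is confined to a strictly smaller branch at \<open>s\<close>. Hence the
  robber eventually has no vertex left, and this strategy admits no infinite play at all.
\<close>

section \<open>Positions from which the robber can be immobilised\<close>

text \<open>It is the cops' turn. The base case is hidden in the second premise, which holds
  vacuously when the robber has no legal reply. Since derivations are well-founded, cops who follow
  one leave the robber no infinite play.\<close>

inductive immobilises :: "'v pair_pre_digraph \<Rightarrow> 'v list \<Rightarrow> 'v \<Rightarrow> bool" for G where
  immobilisesI: "cop_move G cs cs' \<Longrightarrow> (\<And>r'. robber_move G cs' r r' \<Longrightarrow> immobilises G cs' r')
    \<Longrightarrow> immobilises G cs r"

text \<open>A version of \<open>immobilises\<close> with a bound on the number of rounds, from which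
  a natural-number rank of positions is read off.\<close>

fun immobilises_in :: "'v pair_pre_digraph \<Rightarrow> nat \<Rightarrow> 'v list \<Rightarrow> 'v \<Rightarrow> bool" where
  "immobilises_in G 0 cs r \<longleftrightarrow> False"
| "immobilises_in G (Suc n) cs r \<longleftrightarrow>
     (\<exists>cs'. cop_move G cs cs' \<and> (\<forall>r'. robber_move G cs' r r' \<longrightarrow> immobilises_in G n cs' r'))"

lemma immobilises_in_mono:
  assumes "immobilises_in G m cs r" and "m \<le> n"
  shows "immobilises_in G n cs r"
  using assms
proof (induction m arbitrary: n cs r)
  case (Suc m)
  then obtain n' where "n = Suc n'" "m \<le> n'"
    by (cases n) auto
  then show ?case
    using Suc by fastforce
qed simp

lemma finite_robber_moves:
  assumes "finite (parcs G)"
  shows "finite {r'. robber_move G cs r r'}"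
proof (rule finite_subset)
  show "{r'. robber_move G cs r r'} \<subseteq> insert r (snd ` parcs G)"
    by (force simp: robber_move_def step_def)
qed (use assms in auto)

text \<open>The robber has only finitely many replies, so the maximum of their individual bounds
  serves all of them.\<close>

lemma immobilises_imp_immobilises_in:
  assumes "immobilises G cs r" and fin: "finite (parcs G)"
  shows "\<exists>n. immobilises_in G n cs r"
  using assms(1)
proof induction
  case (immobilisesI cs cs' r)
  then obtain f where f: "\<And>r'. robber_move G cs' r r' \<Longrightarrow> immobilises_in G (f r') cs' r'"
    by metis
  \<comment> \<open>If there is no reply, this is an unspecified maximum of the empty set, but then
    nothing has to be bounded.\<close>
  let ?n = "Max (f ` {r'. robber_move G cs' r r'})"
  have "immobilises_in G ?n cs' r'" if "robber_move G cs' r r'" for r'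
    using f[OF that] that finite_robber_moves[OF fin]
    by (elim immobilises_in_mono) simp
  then have "immobilises_in G (Suc ?n) cs r"
    using immobilisesI.hyps(1) by auto
  then show ?case ..
qed

text \<open>The cops choose, from the last position alone, a move after which every reply has lower
  rank. An infinite consistent play would be an infinite descent in the naturals, so none
  exists.\<close>

lemma cops_win_if_immobilises:
  assumes fin: "finite (parcs G)" and c0: "cop_placement G k c0"
    and win: "\<And>r. robber_placement G c0 r \<Longrightarrow> immobilises G c0 r"
  shows "cops_win G k"
proof -
  define rank where "rank cs r = (LEAST n. immobilises_in G n cs r)" for cs r
  define good where "good cs r cs' \<longleftrightarrow> cop_move G cs cs' \<and>
      (\<forall>r'. robber_move G cs' r r' \<longrightarrow> immobilises G cs' r' \<and> rank cs' r' < rank cs r)"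
    for cs r cs'
  have in_imp: "immobilises G cs r" if "immobilises_in G n cs r" for n cs r
    using that by (induction n arbitrary: cs r) (auto intro: immobilisesI)
  have ex_good: "\<exists>cs'. good cs r cs'" if "immobilises G cs r" for cs r
  proof -
    have "immobilises_in G (rank cs r) cs r"
      using immobilises_imp_immobilises_in[OF that fin] unfolding rank_def by (rule LeastI_ex)
    \<comment> \<open>The rank is a successor because \<open>immobilises_in G 0\<close> is
      false.\<close>
    then obtain n cs' where n: "rank cs r = Suc n" and cs': "cop_move G cs cs'"
        "\<And>r'. robber_move G cs' r r' \<Longrightarrow> immobilises_in G n cs' r'"
      by (cases "rank cs r") auto
    have "rank cs' r' \<le> n" if "robber_move G cs' r r'" for r'
      unfolding rank_def using cs'(2)[OF that] by (rule Least_le)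
    then show ?thesis
      unfolding good_def n using cs' in_imp less_Suc_eq_le by blast
  qed
  \<comment> \<open>\<open>cop_strategy\<close> demands a legal move after every history, hence the
    default of staying put.\<close>
  define move where
    "move cs r = (if immobilises G cs r then SOME cs'. good cs r cs' else cs)" for cs r
  define S where "S h = move (fst (last h)) (snd (last h))" for h :: "'a position list"
  have good_move: "good cs r (move cs r)" if "immobilises G cs r" for cs r
    using someI_ex[OF ex_good[OF that]] that by (simp add: move_def)
  have "cop_move G cs (move cs r)" for cs r
    using good_move[of cs r]
    by (cases "immobilises G cs r")
      (auto simp: good_def move_def cop_move_def step_def intro: list.rel_refl)
  then have "cop_strategy G k c0 S"
    using c0 by (simp add: cop_strategy_def S_def)
  moreover have False if play: "consistent_play G c0 S c r" for c r
  proof -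
    have S_play: "S (map (\<lambda>i. (c i, r i)) [0..<Suc n]) = move (c n) (r n)" for n
      by (simp add: S_def)
    have c: "c (Suc n) = move (c n) (r n)" and r: "robber_move G (c (Suc n)) (r n) (r (Suc n))"
      for n
      using play unfolding consistent_play_def S_play by blast+
    have imm: "immobilises G (c n) (r n)" for n
    proof (induction n)
      case 0
      then show ?case using play win unfolding consistent_play_def by metis
    next
      case (Suc n)
      then show ?case using good_move[OF Suc] r[of n] by (simp add: good_def c)
    qed
    define f where "f n = rank (c n) (r n)" for n
    have "\<forall>n. (f (Suc n), f n) \<in> less_than"
      using good_move[OF imm] r by (simp add: good_def c f_def)
    then show False
      using wf_less_than unfolding wf_iff_no_infinite_down_chain by blast
  qed
  ultimately show ?thesis
    unfolding cops_win_def winning_cop_strategy_def by blast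
qed

section \<open>Relocating the cops\<close>

lemma relpowp_step_mono:
  assumes "(step G ^^ m) u v" and "m \<le> n"
  shows "(step G ^^ n) u v"
proof -
  have "(step G ^^ k) v v" for k
    by (induction k) (auto simp: step_def)
  then have "(step G ^^ (m + (n - m))) u v"
    using assms(1) unfolding relpowp_add by blast
  then show ?thesis using assms(2) by simp
qed

text \<open>Cops who have reached their target stay there, so they keep holding \<open>X\<close> while the other cops
  are still walking.\<close>

lemma immobilises_if_relocated:
  assumes "\<And>r. \<lbrakk>r \<in> U; r \<notin> set ds\<rbrakk> \<Longrightarrow> immobilises G ds r"
    and closed: "\<And>u v. \<lbrakk>u \<in> U; step G u v; v \<notin> X\<rbrakk> \<Longrightarrow> v \<in> U"
    and hold: "\<And>x. x \<in> X \<Longrightarrow> (x, x) \<in> set (zip cs ds)"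
    and "list_all2 ((step G) ^^ n) cs ds" and "r \<in> U"
  shows "immobilises G cs r"
  using assms(3-5)
proof (induction n arbitrary: cs r)
  case 0
  then have "cs = ds" by (simp add: list.rel_eq[symmetric] flip: eq_OO)
  \<comment> \<open>The robber may still stand on a vertex of \<open>ds\<close>, so the cops pass
    once: his reply avoids \<open>ds\<close>, hence also \<open>X\<close>, and therefore stays in
    \<open>U\<close>.\<close>
  have *: "immobilises G ds r'" if "robber_move G ds r r'" for r'
  proof -
    have "X \<subseteq> set ds" using 0(1) by (auto dest: set_zip_rightD)
    then show ?thesis
      using that assms(1) closed 0(3) by (auto simp: robber_move_def)
  qed
  show ?case
    unfolding \<open>cs = ds\<close>
    by (rule immobilisesI[of _ _ ds])
      (use * in \<open>auto simp: cop_move_def step_def intro: list.rel_refl\<close>)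
next
  case (Suc n)
  \<comment> \<open>One step of a single cop towards its target; the last conjunct makes a cop
    already there wait.\<close>
  have "\<exists>c'. step G c c' \<and> (step G ^^ n) c' d \<and> (c = d \<longrightarrow> c' = d)"
    if "(step G ^^ Suc n) c d" for c d
  proof (cases "c = d")
    case True
    then show ?thesis
      using relpowp_step_mono[of 0 G d d n] by (auto simp: step_def)
  next
    case False
    then show ?thesis using that by (meson relpowp_Suc_D2)
  qed
  then obtain f where f: "\<And>c d. (step G ^^ Suc n) c d \<Longrightarrow>
      step G c (f c d) \<and> (step G ^^ n) (f c d) d \<and> (c = d \<longrightarrow> f c d = d)"
    by metis
  define cs' where "cs' = map2 f cs ds"
  have len: "length cs = length ds"
    and nth: "\<And>i. i < length ds \<Longrightarrow> (step G ^^ Suc n) (cs ! i) (ds ! i)"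
    using Suc.prems(2) by (auto simp: list_all2_conv_all_nth)
  have move: "cop_move G cs cs'" and dist: "list_all2 ((step G) ^^ n) cs' ds"
    using len f[OF nth] by (auto simp: cop_move_def cs'_def list_all2_conv_all_nth)
  have hold': "(x, x) \<in> set (zip cs' ds)" if "x \<in> X" for x
  proof -
    obtain i where "i < length ds" "cs ! i = x" "ds ! i = x"
      using Suc.prems(1)[OF \<open>x \<in> X\<close>] len by (auto simp: set_zip)
    then show ?thesis
      using len f[OF nth, of i] by (auto simp: set_zip cs'_def intro!: exI[of _ i])
  qed
  show ?case
  proof (rule immobilisesI[OF move])
    fix r' assume r': "robber_move G cs' r r'"
    have "X \<subseteq> set cs'" using hold' by (auto dest: set_zip_leftD)
    then have "r' \<in> U"
      using r' closed[OF Suc.prems(3)] by (auto simp: robber_move_def)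
    then show "immobilises G cs' r'"
      using Suc.IH[OF hold' dist] by blast
  qed
qed

text \<open>For each vertex of \<open>X\<close> one cop already on it is kept there. At least as
  many other cops remain as there are vertices in \<open>Y - X\<close>, so these can be given
  distinct cops.\<close>

lemma ex_relocation:
  assumes "X \<subseteq> Y" and "X \<subseteq> set cs" and "finite Y" and "card Y \<le> length cs"
  obtains ds where "length ds = length cs" and "Y \<subseteq> set ds" and "set ds \<subseteq> Y \<union> set cs"
    and "\<And>x. x \<in> X \<Longrightarrow> (x, x) \<in> set (zip cs ds)"
proof -
  let ?I = "{..<length cs}"
  have "\<forall>x\<in>X. \<exists>i. i < length cs \<and> cs ! i = x"
    using assms(2) by (auto simp: in_set_conv_nth)
  then obtain f where f: "\<And>x. x \<in> X \<Longrightarrow> f x < length cs \<and> cs ! f x = x"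
    by metis
  have inj_f: "inj_on f X" by (metis f inj_onI)
  have fX: "f ` X \<subseteq> ?I" using f by auto
  have finX: "finite X" using assms finite_subset by blast
  have "card (Y - X) \<le> card (?I - f ` X)"
    using assms finX fX by (simp add: card_Diff_subset card_image[OF inj_f])
  then obtain g where g: "g ` (Y - X) \<subseteq> ?I - f ` X" "inj_on g (Y - X)"
    using card_le_inj[of "Y - X" "?I - f ` X"] assms(3) by auto
  define h where "h y = (if y \<in> X then f y else g y)" for y
  have inj_h: "inj_on h Y"
    using inj_f g fX unfolding h_def inj_on_def by (auto split: if_splits)
  have hY: "h ` Y \<subseteq> ?I"
    using fX g(1) by (auto simp: h_def)
  \<comment> \<open>Cops without an assignment keep their vertex, so no target lies outside
    \<open>Y \<union> set cs\<close>.\<close>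
  define ds where "ds = map (\<lambda>i. if i \<in> h ` Y then inv_into Y h i else cs ! i) [0..<length cs]"
  have ds_h: "ds ! h y = y" if "y \<in> Y" for y
    using that hY inj_h by (auto simp: ds_def)
  show thesis
  proof
    show len: "length ds = length cs" by (simp add: ds_def)
    show "Y \<subseteq> set ds"
      using hY ds_h len by (metis image_subset_iff lessThan_iff nth_mem subsetI)
    show "set ds \<subseteq> Y \<union> set cs"
      by (auto simp: ds_def inj_h)
    show "(x, x) \<in> set (zip cs ds)" if "x \<in> X" for x
      using that f[OF that] ds_h[of x] assms(1) len
      by (auto simp: set_zip h_def intro!: exI[of _ "f x"])
  qed
qed

section \<open>Branches of trees\<close>

text \<open>Connectedness is defined through the symmetric closure, which adds no arcs to a
  symmetric digraph.\<close>

lemma connected_imp_rtrancl: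
  assumes "Digraph_Component.connected H" and "symmetric H"
    and "u \<in> verts H" and "v \<in> verts H"
  shows "(u, v) \<in> (arcs_ends H)\<^sup>*"
proof -
  have "(u, v) \<in> (arcs_ends (with_proj (mk_symmetric H)))\<^sup>*"
    using assms
    by (intro reachable_rtranclI)
      (auto simp: Digraph_Component.connected_def strongly_connected_def mk_symmetric_def)
  moreover have "arcs_ends (with_proj (mk_symmetric H)) \<subseteq> arcs_ends H"
    using assms(2) unfolding symmetric_def
    by (auto simp: mk_symmetric_def arcs_ends_conv dest: symD)
  ultimately show ?thesis
    using rtrancl_mono by blast
qed

lemma connected_induced_imp_rtrancl:
  assumes "Digraph_Component.connected (with_proj T \<restriction> A)" and "symmetric (with_proj T)"
    and "u \<in> A" and "v \<in> A"
  shows "(u, v) \<in> (Restr (parcs T) A)\<^sup>*"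
proof -
  have "arcs_ends (with_proj T \<restriction> A) = Restr (parcs T) A"
    by (auto simp: arcs_ends_def arc_to_ends_def induce_subgraph_def)
  moreover from this have "symmetric (with_proj T \<restriction> A)"
    using assms(2) by (auto simp: symmetric_def sym_def)
  ultimately show ?thesis
    using connected_imp_rtrancl[OF assms(1)] assms(3,4) by simp
qed

text \<open>For distinct nodes \<open>s\<close> and \<open>t\<close> of a symmetric
  \<open>T\<close>, this is the component of \<open>s\<close> after deleting
  \<open>t\<close>.\<close>

definition branch :: "'t pair_pre_digraph \<Rightarrow> 't \<Rightarrow> 't \<Rightarrow> 't set" where
  "branch T t s = (Restr (parcs T) (- {t}))\<^sup>* `` {s}"

lemma in_branch_self: "s \<in> branch T t s"
  by (simp add: branch_def)

lemma branch_step: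
  assumes "x \<in> branch T t s" and "(x, y) \<in> parcs T" and "x \<noteq> t" and "y \<noteq> t"
  shows "y \<in> branch T t s"
  using assms unfolding branch_def by (auto intro: rtrancl_into_rtrancl)

lemma root_notin_branch:
  assumes "s \<noteq> t"
  shows "t \<notin> branch T t s"
proof
  assume "t \<in> branch T t s"
  then have "(s, t) \<in> (Restr (parcs T) (- {t}))\<^sup>*" by (simp add: branch_def)
  then show False using assms by cases auto
qed

text \<open>Cut a path at its last visit to its starting node.\<close>

lemma rtrancl_imp_in_branch:
  assumes "(s, x) \<in> R\<^sup>*" and "R \<subseteq> parcs T" and "x \<noteq> s"
  shows "\<exists>s'. (s, s') \<in> R \<and> x \<in> branch T s s'"
  using assms(1,3)
proof induction
  case (step x y)
  show ?case
  proof (cases "x = s")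
    case True
    then show ?thesis using step.hyps in_branch_self by metis
  next
    case False
    then show ?thesis
      using step assms(2) branch_step[of x T s _ y] by blast
  qed
qed simp

locale tree_graph =
  fixes T :: "'t pair_pre_digraph"
  assumes undirected_tree: "undirected_tree T"
begin

sublocale pair_graph T
  using undirected_tree by (simp add: undirected_tree_def)

lemma arcs_sym: "(x, y) \<in> parcs T \<Longrightarrow> (y, x) \<in> parcs T"
  using pair_sym_arcs by (auto simp: symmetric_def dest: symD)

lemma arcs_neq: "(x, y) \<in> parcs T \<Longrightarrow> x \<noteq> y"
  using pair_no_loops by fastforce

lemma finite_branch:
  assumes "s \<in> pverts T"
  shows "finite (branch T t s)"
proof (rule finite_subset)
  have "x \<in> pverts T" if "(s, x) \<in> (Restr (parcs T) (- {t}))\<^sup>*" for x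
    using that assms by induction (auto dest: in_arcsD2)
  then show "branch T t s \<subseteq> pverts T" by (auto simp: branch_def)
qed (rule pair_finite_verts)

text \<open>Otherwise a path between the two neighbours inside the branch closes up through \<open>t\<close> to a
  cycle.\<close>

lemma branch_neighbour_unique:
  assumes ts: "(t, s) \<in> parcs T" "(t, s') \<in> parcs T" and s': "s' \<in> branch T t s"
  shows "s' = s"
proof (rule ccontr)
  assume "s' \<noteq> s"
  \<comment> \<open>Deleting \<open>t\<close> yields a digraph in which reachability provides a
    simple path; its nodes then automatically avoid \<open>t\<close>.\<close>
  define H where "H = \<lparr>pverts = pverts T - {t}, parcs = Restr (parcs T) (- {t})\<rparr>"
  interpret H: pair_wf_digraph H
    by unfold_locales (auto simp: H_def dest: in_arcsD1 in_arcsD2)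
  have "s \<in> pverts H" "s' \<in> pverts H"
    using ts arcs_neq by (auto simp: H_def dest: in_arcsD2)
  moreover have "(s, s') \<in> (parcs H)\<^sup>*"
    using s' by (simp add: branch_def H_def)
  ultimately have "s \<rightarrow>\<^sup>*\<^bsub>with_proj H\<^esub> s'"
    using H.reachable_conv by simp
  then obtain p where p: "H.apath s p s'"
    using H.reachable_apath by blast
  then have walk: "H.awalk s p s'" and dist: "distinct (pawalk_verts s p)"
    by (auto simp: H.apath_def)
  have "t \<notin> set (pawalk_verts s p)"
    using H.awalk_verts_in_verts[of s p t] walk unfolding H.awalk_def by (auto simp: H_def)
  have "p \<noteq> []"
    using walk \<open>s' \<noteq> s\<close> by (auto simp: H.awalk_def)
  have pcas_snoc: "pcas u (q @ [(v, w)]) w" if "pcas u q v" for u q and v w :: 't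
    using that by (induction u q v rule: pcas.induct) auto
  have verts_snoc: "pawalk_verts u (q @ [(v, w)]) = pawalk_verts u q @ [w]" if "pcas u q v"
    for u q and v w :: 't
    using that by (induction u q v rule: pcas.induct) auto
  let ?c = "(t, s) # p @ [(s', t)]"
  have "pcas s p s'" "set p \<subseteq> parcs T"
    using walk unfolding H.awalk_def by (auto simp: H_def)
  then have "awalk t ?c t"
    using ts arcs_sym pcas_snoc by (auto simp: awalk_def dest: in_arcsD1)
  moreover have "distinct (tl (pawalk_verts t ?c))"
    using verts_snoc[OF \<open>pcas s p s'\<close>] dist \<open>t \<notin> _\<close> by simp
  ultimately have "cycle ?c"
    unfolding cycle_def by blast
  moreover have "3 \<le> length ?c"
    using \<open>p \<noteq> []\<close> by (cases p) auto
  ultimately show False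
    using undirected_tree unfolding undirected_tree_def by blast
qed

text \<open>A path from \<open>s'\<close> avoiding \<open>s\<close> starts inside the larger branch.
  To leave it, the path would have to enter \<open>t\<close> from a neighbour of \<open>t\<close> in
  that branch, and the only one is \<open>s\<close>. Strictness is witnessed by \<open>s\<close>
  itself.\<close>

lemma branch_psubset:
  assumes ts: "(t, s) \<in> parcs T" and ss': "(s, s') \<in> parcs T" and "s' \<noteq> t"
  shows "branch T s s' \<subset> branch T t s"
proof -
  have "y \<in> branch T t s" if "(s', y) \<in> (Restr (parcs T) (- {s}))\<^sup>*" for y
    using that
  proof induction
    case base
    show ?case
      using branch_step[OF in_branch_self ss', of t] arcs_neq[OF ts] \<open>s' \<noteq> t\<close> by simp
  next
    case (step y z)
    have "y \<noteq> t"
      using step.IH root_notin_branch[of s t T] arcs_neq[OF ts] by blast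
    moreover have "z \<noteq> t"
    proof
      assume "z = t"
      then have "y = s"
        using step branch_neighbour_unique[OF ts _ step.IH] arcs_sym by blast
      then show False using step.hyps(2) by simp
    qed
    ultimately show ?case
      using branch_step[OF step.IH] step.hyps(2) by blast
  qed
  then have "branch T s s' \<subseteq> branch T t s" by (auto simp: branch_def)
  moreover have "s \<notin> branch T s s'"
    using root_notin_branch arcs_neq[OF ss'] by metis
  ultimately show ?thesis
    using in_branch_self[of s T t] by blast
qed

text \<open>Paths inside \<open>A\<close> never meet \<open>t\<close>, so they cannot leave the
  branch. This is applied to the nodes whose bags contain a given vertex of the robber's
  territory.\<close>

lemma connected_subset_branch:
  assumes conn: "\<And>y. y \<in> A \<Longrightarrow> (x, y) \<in> (Restr (parcs T) A)\<^sup>*"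
    and "x \<in> branch T t s" and "t \<notin> A"
  shows "A \<subseteq> branch T t s"
proof
  fix y assume "y \<in> A"
  then have "(x, y) \<in> (Restr (parcs T) A)\<^sup>*" by (rule conn)
  then show "y \<in> branch T t s"
  proof induction
    case (step y z)
    then show ?case using assms(3) by (blast intro: branch_step)
  qed (rule assms(2))
qed

text \<open>The only arc from the branch to \<open>t\<close> starts at \<open>s\<close>, so a path
  to \<open>t\<close> passes through \<open>s\<close>. For the nodes whose bags contain a vertex
  \<open>v\<close> of \<open>B t\<close>, this yields \<open>v \<in> B s\<close>.\<close>

lemma connected_leaves_branch_through_neighbour:
  assumes ts: "(t, s) \<in> parcs T" and path: "(x, t) \<in> (Restr (parcs T) A)\<^sup>*"
    and "x \<in> branch T t s"
  shows "s \<in> A"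
proof (rule ccontr)
  assume "s \<notin> A"
  have t: "t \<notin> branch T t s"
    using root_notin_branch arcs_neq[OF ts] by metis
  have "y \<in> branch T t s" if "(x, y) \<in> (Restr (parcs T) A)\<^sup>*" for y
    using that
  proof induction
    case (step y z)
    have "z \<noteq> t"
      using step branch_neighbour_unique[OF ts _ step.IH] arcs_sym \<open>s \<notin> A\<close> by blast
    then show ?case
      using step t by (blast intro: branch_step)
  qed (rule assms(3))
  with t path show False by blast
qed

end

section \<open>The cops' strategy along a tree decomposition\<close>

text \<open>Staying put pads walks to a common length; \<open>immobilises_if_relocated\<close> lets
  all cops walk for the same number of rounds.\<close>

lemma ex_uniform_distance:
  assumes "pair_graph G" and conn: "Digraph_Component.connected (with_proj G)"
  shows "\<exists>n. \<forall>u\<in>pverts G. \<forall>v\<in>pverts G. (step G ^^ n) u v"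
proof -
  interpret pair_graph G by fact
  have "\<exists>m. (step G ^^ m) u v" if "u \<in> pverts G" "v \<in> pverts G" for u v
  proof -
    have "(u, v) \<in> (parcs G)\<^sup>*"
      using connected_imp_rtrancl[OF conn pair_sym_arcs] that by simp
    then have "(step G)\<^sup>*\<^sup>* u v"
      by induction (auto simp: step_def intro: rtranclp.rtrancl_into_rtrancl)
    then show ?thesis by (rule rtranclp_imp_relpowp)
  qed
  then obtain f where f: "\<And>u v. \<lbrakk>u \<in> pverts G; v \<in> pverts G\<rbrakk> \<Longrightarrow> (step G ^^ f u v) u v"
    by metis
  let ?n = "Max ((\<lambda>(u, v). f u v) ` (pverts G \<times> pverts G))"
  have "f u v \<le> ?n" if "u \<in> pverts G" "v \<in> pverts G" for u v
    using that pair_finite_verts by (intro Max_ge) auto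
  then have "\<forall>u\<in>pverts G. \<forall>v\<in>pverts G. (step G ^^ ?n) u v"
    using f relpowp_step_mono by metis
  then show ?thesis ..
qed

text \<open>The invariant of the strategy, proved by induction on the size of the branch:
  \<open>B t\<close> is guarded and the robber is in a bag beyond the arc from \<open>t\<close> to
  \<open>s\<close>.\<close>

lemma immobilises_branch:
  fixes G :: "'v pair_pre_digraph" and T :: "'t pair_pre_digraph"
  assumes G: "pair_graph G" "Digraph_Component.connected (with_proj G)"
    and dec: "tree_decomposition G T B"
    and small: "\<And>t. t \<in> pverts T \<Longrightarrow> card (B t) \<le> k"
    and "(t, s) \<in> parcs T" and "cop_placement G k cs" and "B t \<subseteq> set cs"
    and "x \<in> branch T t s" and "x \<in> pverts T" and "r \<in> B x" and "r \<notin> B t"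
  shows "immobilises G cs r"
  using assms(5-)
proof (induction "card (branch T t s)" arbitrary: t s cs x r rule: less_induct)
  case less
  note ts = \<open>(t, s) \<in> parcs T\<close>
  interpret G: pair_graph G by fact
  interpret tree_graph T
    using dec by unfold_locales (simp add: tree_decomposition_def)
  have bags: "(\<Union>t\<in>pverts T. B t) = pverts G"
    and edge: "\<And>u v. (u, v) \<in> parcs G \<Longrightarrow> \<exists>t\<in>pverts T. u \<in> B t \<and> v \<in> B t"
    using dec by (auto simp: tree_decomposition_def)
  let ?N = "\<lambda>v. {t \<in> pverts T. v \<in> B t}"
  have conn: "(x, y) \<in> (Restr (parcs T) (?N v))\<^sup>*" if "x \<in> ?N v" "y \<in> ?N v" for v x y
  proof (rule connected_induced_imp_rtrancl[OF _ pair_sym_arcs that])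
    have "v \<in> pverts G" using that bags by auto
    then show "Digraph_Component.connected (with_proj T \<restriction> ?N v)"
      using dec by (simp add: tree_decomposition_def)
  qed
  have t: "t \<in> pverts T" and s: "s \<in> pverts T"
    using ts by (auto dest: in_arcsD1 in_arcsD2)
  have Bs: "B s \<subseteq> pverts G" using s bags by auto
  have finBs: "finite (B s)" using Bs G.pair_finite_verts by (rule finite_subset)
  have cs: "length cs = k" "set cs \<subseteq> pverts G"
    using \<open>cop_placement G k cs\<close> by (auto simp: cop_placement_def)
  define X where "X = B t \<inter> B s"
  \<comment> \<open>The robber's territory; by \<open>nodes\<close> below, its vertices occur only
    in bags of the branch. The cops holding \<open>X\<close> are its guards during the walk.\<close>
  define U where "U = {v. v \<notin> B t \<and> (\<exists>x \<in> branch T t s \<inter> pverts T. v \<in> B x)}"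
  have nodes: "?N u \<subseteq> branch T t s" if "u \<in> U" for u
  proof -
    obtain x where "x \<in> branch T t s" "x \<in> ?N u" and "t \<notin> ?N u"
      using \<open>u \<in> U\<close> unfolding U_def by blast
    then show ?thesis
      using connected_subset_branch[of "?N u" x] conn by blast
  qed
  \<comment> \<open>A robber's step runs inside a bag of the branch. If it ended in
    \<open>B t\<close>, the nodes of \<open>v\<close> would connect that bag to \<open>t\<close>
    through \<open>s\<close>, forcing \<open>v \<in> X\<close>.\<close>
  have closed: "v \<in> U" if "u \<in> U" "step G u v" "v \<notin> X" for u v
  proof (cases "v = u")
    case False
    then obtain y where y: "y \<in> pverts T" "u \<in> B y" "v \<in> B y"
      using \<open>step G u v\<close> edge by (auto simp: step_def)
    then have "y \<in> branch T t s" using nodes[OF \<open>u \<in> U\<close>] by blast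
    moreover have "v \<notin> B t"
    proof
      assume "v \<in> B t"
      then have "(y, t) \<in> (Restr (parcs T) (?N v))\<^sup>*"
        using conn t y by blast
      then have "s \<in> ?N v"
        using connected_leaves_branch_through_neighbour[OF ts] \<open>y \<in> branch T t s\<close> by blast
      then show False using \<open>v \<in> B t\<close> \<open>v \<notin> X\<close> by (simp add: X_def)
    qed
    ultimately show ?thesis using y by (auto simp: U_def)
  qed (use that in simp)
  obtain ds where ds: "length ds = k" "B s \<subseteq> set ds" "set ds \<subseteq> B s \<union> set cs"
    and hold: "\<And>x. x \<in> X \<Longrightarrow> (x, x) \<in> set (zip cs ds)"
    using ex_relocation[of X "B s" cs] \<open>B t \<subseteq> set cs\<close> finBs small[OF s] cs(1)
    unfolding X_def by auto
  have placed: "cop_placement G k ds"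
    using ds cs Bs by (auto simp: cop_placement_def)
  obtain n where n: "\<And>u v. \<lbrakk>u \<in> pverts G; v \<in> pverts G\<rbrakk> \<Longrightarrow> (step G ^^ n) u v"
    using ex_uniform_distance[OF G] by blast
  have dist: "list_all2 (step G ^^ n) cs ds"
    using cs placed n by (auto simp: list_all2_conv_all_nth cop_placement_def subset_iff)
  have after: "immobilises G ds r'" if "r' \<in> U" "r' \<notin> set ds" for r'
  proof -
    obtain y where y: "y \<in> branch T t s" "y \<in> pverts T" "r' \<in> B y"
      using \<open>r' \<in> U\<close> by (auto simp: U_def)
    have "y \<noteq> s" using y ds \<open>r' \<notin> set ds\<close> by blast
    \<comment> \<open>Cutting the path from \<open>s\<close> to \<open>y\<close> at its last visit
      to \<open>s\<close> gives the next arc. The restricted relation ensures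
      \<open>s' \<noteq> t\<close>, so the new branch is strictly smaller.\<close>
    then obtain s' where s': "(s, s') \<in> Restr (parcs T) (- {t})" "y \<in> branch T s s'"
      using y(1) rtrancl_imp_in_branch[of s y "Restr (parcs T) (- {t})" T]
      by (auto simp: branch_def)
    have "card (branch T s s') < card (branch T t s)"
      using s' ts finite_branch[OF s] by (intro psubset_card_mono branch_psubset) auto
    then show ?thesis
      using less.hyps[of s s' ds y r'] s' placed ds y \<open>r' \<notin> set ds\<close> by blast
  qed
  show ?case
  proof (rule immobilises_if_relocated[where U = U and X = X and ds = ds and n = n])
    show "immobilises G ds r'" if "r' \<in> U" "r' \<notin> set ds" for r'
      using that by (rule after)
    show "v \<in> U" if "u \<in> U" "step G u v" "v \<notin> X" for u v
      using that by (rule closed)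
    show "(x, x) \<in> set (zip cs ds)" if "x \<in> X" for x
      using that by (rule hold)
    show "list_all2 (step G ^^ n) cs ds" by (rule dist)
    show "r \<in> U" using less.prems by (auto simp: U_def)
  qed
qed

lemma cops_win_tree_decomposition:
  fixes G :: "'v pair_pre_digraph" and T :: "'t pair_pre_digraph"
  assumes G: "pair_graph G" "Digraph_Component.connected (with_proj G)"
    and dec: "tree_decomposition G T B"
  shows "cops_win G (width T B + 1)"
proof -
  interpret G: pair_graph G by fact
  interpret tree_graph T
    using dec by unfold_locales (simp add: tree_decomposition_def)
  have bags: "(\<Union>t\<in>pverts T. B t) = pverts G"
    using dec by (simp add: tree_decomposition_def)
  have connT: "Digraph_Component.connected (with_proj T)"
    using undirected_tree by (simp add: undirected_tree_def)
  have small: "card (B t) \<le> width T B + 1" if "t \<in> pverts T" for t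
  proof -
    have "card (B t) \<le> Max ((\<lambda>t. card (B t)) ` pverts T)"
      using that pair_finite_verts by (intro Max_ge) auto
    then show ?thesis by (simp add: width_def)
  qed
  obtain t where t: "t \<in> pverts T"
    using connT
    by (auto simp: Digraph_Component.connected_def strongly_connected_def mk_symmetric_def)
  obtain v where v: "v \<in> pverts G"
    using G(2)
    by (auto simp: Digraph_Component.connected_def strongly_connected_def mk_symmetric_def)
  have Bt: "B t \<subseteq> pverts G" using t bags by auto
  have "finite (B t)" using Bt G.pair_finite_verts by (rule finite_subset)
  \<comment> \<open>Here \<open>ex_relocation\<close> only builds the initial placement: starting
    from all cops on \<open>v\<close>, enough are reassigned to fill \<open>B t\<close>, and the
    others stay on \<open>v\<close>.\<close>
  then obtain cs where cs: "length cs = length (replicate (width T B + 1) v)" "B t \<subseteq> set cs"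
      "set cs \<subseteq> B t \<union> set (replicate (width T B + 1) v)"
    by (rule ex_relocation[of "{}" _ "replicate (width T B + 1) v", rotated 2])
      (use small[OF t] in simp_all)
  then have "set cs \<subseteq> pverts G" using Bt v by fastforce
  show ?thesis
  proof (rule cops_win_if_immobilises[OF G.pair_finite_arcs])
    show placed: "cop_placement G (width T B + 1) cs"
      using cs(1) \<open>set cs \<subseteq> pverts G\<close> by (simp add: cop_placement_def)
    fix r assume "robber_placement G cs r"
    then have r: "r \<in> pverts G" "r \<notin> B t"
      using cs by (auto simp: robber_placement_def)
    then obtain x where x: "x \<in> pverts T" "r \<in> B x"
      using bags by blast
    have path: "(t, x) \<in> (parcs T)\<^sup>*"
      using connected_imp_rtrancl[OF connT pair_sym_arcs] t x by simp
    have "x \<noteq> t" using x r by blast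
    then obtain s where s: "(t, s) \<in> parcs T" "x \<in> branch T t s"
      using rtrancl_imp_in_branch[OF path subset_refl] by blast
    show "immobilises G cs r"
      by (rule immobilises_branch[OF G dec small s(1) placed cs(2) s(2) x r(2)])
  qed
qed

theorem theorem9:
  fixes G :: "'v pair_pre_digraph"
  assumes "pair_graph G"
    and "Digraph_Component.connected (with_proj G)"
  shows "surrounding_cop_number G \<le> treewidth G + 1"
proof -
  have "\<exists>(T :: nat pair_pre_digraph) B. tree_decomposition G T B \<and> width T B = treewidth G"
    unfolding treewidth_def
    by (rule LeastI_ex) (use treewidth_well_defined[OF assms(1)] in blast)
  then have "cops_win G (treewidth G + 1)"
    using cops_win_tree_decomposition[OF assms] by metis
  \<comment> \<open>The summand 1 also guarantees that at least one cop plays, as the minimum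
    requires.\<close>
  then show ?thesis
    unfolding surrounding_cop_number_def by (intro Least_le) simp
qed

end
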